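(* Let $p$ be a prime, $K$ an F-finite field of characteristic $p$, and let $I=(m_1,m_2,\dots,m_t)\subseteq S=K[x_1,\dots,x_n]$ be a monomial ideal of height $1$ generated by monomials $m_1,\dots,m_t$ such that $x_1\mid m_i$ for all $i$. For each $i$, let $d_i$ denote the power of $x_1$ in $m_i$, and suppose that $d=d_1<d_i$ for all $i>1$. Suppose also that $m_1=m^d$ for some squarefree monomial $m$. Then $\operatorname{lce}(I)=1/d$.
   Context: $K$ is F-finite if it is finitely generated over $K^p$. $q$ always denotes a power $p^e$, $e\ge 0$. For an ideal $J\subseteq S$, $J^{[q]}=(f^q\mid f\in J)$ and $J^{[1/q]}$ is the smallest ideal $L$ with $L^{[q]}\supseteq J$. For an integer $k\ge 0$ with base $p$ expansion $k=k_0+k_1p+\cdots+k_rp^r$, $I^{[k]}=I^{k_0}(I^{k_1})^{[p]}\cdots(I^{k_r})^{[p^r]}$. Put $I^{[k/q]}=(I^{[k]})^{[1/q]}$. For real $\lambda\ge 0$, $I^{[\lambda]}$ is the stable value of the ascending chain $I^{[\lambda_1]}\subseteq I^{[\lambda_2]}\subseteq\cdots$ for any monotone decreasing sequence $(\lambda_j)$ of rationals of the form $k/q$ converging to $\lambda$ from above. A critical exponent of $I$ is a real number $\lambda>0$ such that $I^{[\mu]}\ne I^{[\lambda]}$ for all $0\le\mu<\lambda$; $\operatorname{lce}(I)$ denotes the least (positive) critical exponent of $I$. *)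

theory Defs
  imports
    "HOL-Library.Poly_Mapping"
    "HOL-Library.Extended_Nat"
    "HOL-Library.Log_Nat"
    "HOL-Algebra.Ideal_Product"
    "HOL-Algebra.Embedded_Algebras"
    "HOL-Decision_Procs.Algebra_Aux"
    "HOL-Computational_Algebra.Computational_Algebra"
begin

text \<open>
  The polynomial ring over \<open>'k\<close> with variables indexed by the finite type \<open>'n\<close>: finitely supported
  functions from exponent vectors to coefficients, with the convolution product. Ideals are those of
  HOL-Algebra, taken in the ring structure \<^const>\<open>cring_class_ops\<close> which a type of class
  \<open>comm_ring_1\<close> carries.
\<close>

type_synonym ('n, 'k) mpoly = "('n \<Rightarrow>\<^sub>0 nat) \<Rightarrow>\<^sub>0 'k"

definition monomial_of :: "('n \<Rightarrow>\<^sub>0 nat) \<Rightarrow> ('n, 'k::comm_ring_1) mpoly" where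
  "monomial_of a = Poly_Mapping.single a 1"

definition variable :: "'n \<Rightarrow> ('n, 'k::comm_ring_1) mpoly" where
  "variable v = monomial_of (Poly_Mapping.single v 1)"


text \<open>\<open>Span\<close> is the linear span over the subfield \<open>K\<^sup>p\<close>: finite generation is meant as a module.\<close>

definition F_finite :: "'k::field itself \<Rightarrow> bool" where
  "F_finite _ \<longleftrightarrow>
     (\<exists>us :: 'k list. ring.Span cring_class_ops (range (\<lambda>x. x ^ CHAR('k))) us = UNIV)"


definition prime_height :: "'a::comm_ring_1 set \<Rightarrow> enat" where
  "prime_height P = Sup {enat h |h. \<exists>Q :: nat \<Rightarrow> 'a set.
     (\<forall>i\<le>h. primeideal (Q i) cring_class_ops) \<and> (\<forall>i<h. Q i \<subset> Q (Suc i)) \<and> Q h = P}"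

definition ideal_height :: "'a::comm_ring_1 set \<Rightarrow> enat" where
  "ideal_height J = Inf {prime_height P |P. primeideal P cring_class_ops \<and> J \<subseteq> P}"


text \<open>\<open>J\<^sup>[\<^sup>q\<^sup>]\<close> and \<open>J\<^sup>[\<^sup>1\<^sup>/\<^sup>q\<^sup>]\<close>; in the latter, \<open>LEAST\<close> is with respect to inclusion.\<close>

definition frob_power :: "nat \<Rightarrow> 'a::comm_ring_1 set \<Rightarrow> 'a set" where
  "frob_power q J = Idl\<^bsub>cring_class_ops\<^esub> ((\<lambda>f. f ^ q) ` J)"

definition frob_root :: "nat \<Rightarrow> 'a::comm_ring_1 set \<Rightarrow> 'a set" where
  "frob_root q J = (LEAST L. ideal L cring_class_ops \<and> J \<subseteq> frob_power q L)"


text \<open>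
  \<open>I\<^sup>[\<^sup>k\<^sup>]\<close>: the \<open>i\<close>-th base \<open>p\<close> digit of \<open>k\<close> is \<open>k div p ^ i mod p\<close>, and
  \<^term>\<open>floorlog p k\<close> is the number of digits (\<open>0\<close> for \<open>k = 0\<close>, so \<open>I\<^sup>[\<^sup>0\<^sup>]\<close> is the unit ideal).
  Powers and products are taken in the monoid of ideals.
\<close>

definition digit_power :: "nat \<Rightarrow> 'a::comm_ring_1 set \<Rightarrow> nat \<Rightarrow> 'a set" where
  "digit_power p I k =
     (\<Otimes>\<^bsub>ideals_set cring_class_ops\<^esub> i \<in> {..<floorlog p k}.
        frob_power (p ^ i) (I [^]\<^bsub>ideals_set cring_class_ops\<^esub> (k div p ^ i mod p)))"

text \<open>\<open>I\<^sup>[\<^sup>k\<^sup>/\<^sup>q\<^sup>]\<close> for \<open>q = p ^ e\<close>\<close>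

definition digit_power_frac :: "nat \<Rightarrow> 'a::comm_ring_1 set \<Rightarrow> nat \<Rightarrow> nat \<Rightarrow> 'a set" where
  "digit_power_frac p I k e = frob_root (p ^ e) (digit_power p I k)"

text \<open>
  \<open>I\<^sup>[\<^sup>\<lambda>\<^sup>]\<close> for real \<open>\<lambda>\<close>: the common eventual value along all decreasing sequences
  \<open>k j / p ^ e j\<close> that tend to \<open>\<lambda>\<close> from above.
\<close>

definition digit_power_real :: "nat \<Rightarrow> 'a::comm_ring_1 set \<Rightarrow> real \<Rightarrow> 'a set" where
  "digit_power_real p I l = (THE A. \<forall>k e :: nat \<Rightarrow> nat.
     decseq (\<lambda>j. real (k j) / real (p ^ e j)) \<and>
     (\<forall>j. l < real (k j) / real (p ^ e j)) \<and>
     (\<lambda>j. real (k j) / real (p ^ e j)) \<longlonglongrightarrow> l \<longrightarrow>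
     (\<forall>\<^sub>F j in sequentially. digit_power_frac p I (k j) (e j) = A))"

definition critical_exponent :: "nat \<Rightarrow> 'a::comm_ring_1 set \<Rightarrow> real \<Rightarrow> bool" where
  "critical_exponent p I l \<longleftrightarrow>
     0 < l \<and> (\<forall>u. 0 \<le> u \<and> u < l \<longrightarrow> digit_power_real p I u \<noteq> digit_power_real p I l)"

definition lce :: "nat \<Rightarrow> 'a::comm_ring_1 set \<Rightarrow> real" where
  "lce p I = (LEAST l. critical_exponent p I l)"

end

theory Submission
  imports Defs "HOL-Library.Set_Algebras"
begin

text \<open>
  Every ideal involved is monomial. For \<open>q = p\<^sup>e\<close>, a \<open>p\<^sup>-\<^sup>e\<close>-linear splitting of the Frobenius map shows
  that \<open>J\<^sup>[\<^sup>1\<^sup>/\<^sup>q\<^sup>]\<close> is obtained from a monomial ideal \<open>J\<close> by dividing the exponents by \<open>q\<close>, rounding down.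
  The exponents generating \<open>I\<^sup>[\<^sup>k\<^sup>]\<close> are sums of \<open>k\<close> exponents of generators of \<open>I\<close>, and include \<open>k\<close>
  times each single one. If \<open>k / q < 1 / d\<close>, then \<open>m\<^sub>1\<^sup>k = m\<^sup>d\<^sup>k\<close> has all exponents below \<open>q\<close>, so
  \<open>I\<^sup>[\<^sup>k\<^sup>/\<^sup>q\<^sup>]\<close> is the unit ideal; if \<open>k / q > 1 / d\<close>, every exponent of \<open>x\<^sub>1\<close> is at least \<open>d k > q\<close>, so
  \<open>I\<^sup>[\<^sup>k\<^sup>/\<^sup>q\<^sup>] \<subseteq> (x\<^sub>1)\<close>. The stable value at \<open>1 / d\<close> exists because \<open>I\<^sup>[\<^sup>k\<^sup>/\<^sup>q\<^sup>]\<close> is antitone in \<open>k / q\<close> and,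
  for \<open>k / q \<le> 2\<close>, is generated in bounded exponents and hence takes finitely many values.
\<close>


section \<open>Monomial ideals\<close>

lemma ring_class: "ring cring_class_ops"
  using cring_class by (rule cring.axioms)

lemma ideal_class_iff:
  "ideal J cring_class_ops \<longleftrightarrow>
     0 \<in> J \<and> (\<forall>x\<in>J. \<forall>y\<in>J. x + y \<in> J) \<and> (\<forall>x\<in>J. \<forall>y. y * x \<in> J)"
  for J :: "'a::comm_ring_1 set"
proof
  assume "ideal J cring_class_ops"
  then interpret ideal J cring_class_ops .
  show "0 \<in> J \<and> (\<forall>x\<in>J. \<forall>y\<in>J. x + y \<in> J) \<and> (\<forall>x\<in>J. \<forall>y. y * x \<in> J)"
    using zero_closed a_closed I_l_closed by (simp add: class_simps)
next
  assume J: "0 \<in> J \<and> (\<forall>x\<in>J. \<forall>y\<in>J. x + y \<in> J) \<and> (\<forall>x\<in>J. \<forall>y. y * x \<in> J)"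
  have inv: "inv\<^bsub>add_monoid cring_class_ops\<^esub> x = - x" for x :: 'a
    using uminus_class[of x] by (simp add: a_inv_def)
  \<comment> \<open>Closure under negation comes from absorption with the multiplier -1.\<close>
  have uminus: "- x \<in> J" if "x \<in> J" for x
    using J that by (metis mult_minus1)
  show "ideal J cring_class_ops"
  proof (rule idealI)
    show "ring (cring_class_ops :: 'a ring)"
      by (rule ring_class)
    show "subgroup J (add_monoid cring_class_ops)"
      by (rule subgroup.intro) (use J inv uminus in \<open>auto simp: cring_class_ops_def\<close>)
  qed (use J in \<open>auto simp: class_simps mult.commute\<close>)
qed

lemma ideal_Idl_class: "ideal (Idl\<^bsub>cring_class_ops\<^esub> S) cring_class_ops"
  for S :: "'a::comm_ring_1 set"
  by (rule ring.genideal_ideal[OF ring_class]) (simp add: cring_class_ops_def)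

lemma Idl_class_superset: "S \<subseteq> Idl\<^bsub>cring_class_ops\<^esub> S"
  for S :: "'a::comm_ring_1 set"
  by (rule ring.genideal_self[OF ring_class]) (simp add: cring_class_ops_def)

text \<open>A polynomial is the finite sum of its terms, so an additively closed property can be
  checked on single terms with exponents in \<open>U\<close>.\<close>

lemma poly_mapping_keys_induct [consumes 1, case_names zero single add]:
  fixes f :: "'a \<Rightarrow>\<^sub>0 'b::comm_monoid_add"
  assumes "Poly_Mapping.keys f \<subseteq> U"
    and "P 0"
    and "\<And>a c. a \<in> U \<Longrightarrow> P (Poly_Mapping.single a c)"
    and "\<And>f g. P f \<Longrightarrow> P g \<Longrightarrow> P (f + g)"
  shows "P f"
proof -
  have f: "f = (\<Sum>a\<in>Poly_Mapping.keys f. Poly_Mapping.single a (Poly_Mapping.lookup f a))"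
    by (rule poly_mapping_eqI)
       (auto simp: lookup_sum lookup_single when_def in_keys_iff)
  have "P (\<Sum>a\<in>B. Poly_Mapping.single a (Poly_Mapping.lookup f a))"
    if "finite B" "B \<subseteq> U" for B
    using that by induction (use assms(2-4) in auto)
  then show ?thesis
    using f assms(1) by (metis finite_keys)
qed

text \<open>The up-closure in the componentwise order: exponents of the monomials divisible by one
  with exponent in \<open>A\<close>.\<close>

definition above :: "('n \<Rightarrow>\<^sub>0 nat) set \<Rightarrow> ('n \<Rightarrow>\<^sub>0 nat) set" where
  "above A = {c. \<exists>a\<in>A. \<forall>v. Poly_Mapping.lookup a v \<le> Poly_Mapping.lookup c v}"

text \<open>Described by supports, so that membership is tested term by term;
  \<open>Idl_monomials\<close> identifies it with the ideal generated by the monomials with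
  exponents in \<open>A\<close>.\<close>

definition mono_ideal :: "('n \<Rightarrow>\<^sub>0 nat) set \<Rightarrow> ('n, 'k::comm_ring_1) mpoly set" where
  "mono_ideal A = {f. Poly_Mapping.keys f \<subseteq> above A}"

lemma aboveI: "a \<in> A \<Longrightarrow> (\<And>v. Poly_Mapping.lookup a v \<le> Poly_Mapping.lookup c v) \<Longrightarrow> c \<in> above A"
  by (auto simp: above_def)

lemma above_subset_iff: "above A \<subseteq> above B \<longleftrightarrow> A \<subseteq> above B"
proof
  assume "above A \<subseteq> above B"
  then show "A \<subseteq> above B"
    by (auto intro: aboveI)
next
  assume "A \<subseteq> above B"
  then show "above A \<subseteq> above B"
    unfolding above_def subset_iff mem_Collect_eq by (meson order_trans)
qed

lemma above_add: "a \<in> above A \<Longrightarrow> b \<in> above B \<Longrightarrow> a + b \<in> above (A + B)"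
  unfolding above_def mem_Collect_eq
  by (elim bexE, rule bexI[OF _ set_plus_intro]) (auto simp: lookup_add intro: add_mono)

lemma above_add_left: "a \<in> above A \<Longrightarrow> b + a \<in> above A"
  by (auto simp: above_def lookup_add intro: trans_le_add2)

lemma monomial_of_in_mono_ideal_iff [simp]:
  "(monomial_of c :: ('n, 'k::comm_ring_1) mpoly) \<in> mono_ideal A \<longleftrightarrow> c \<in> above A"
  by (simp add: mono_ideal_def monomial_of_def)

lemma mono_ideal_mono: "A \<subseteq> above B \<Longrightarrow> mono_ideal A \<subseteq> mono_ideal B"
  using above_subset_iff[of A B] by (auto simp: mono_ideal_def)

lemma ideal_mono_ideal: "ideal (mono_ideal A :: ('n, 'k::comm_ring_1) mpoly set) cring_class_ops"
  unfolding ideal_class_iff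
proof (intro conjI ballI allI)
  fix f g :: "('n, 'k) mpoly"
  assume f: "f \<in> mono_ideal A"
  then show "g * f \<in> mono_ideal A"
    using keys_mult[of g f] by (auto simp: mono_ideal_def intro: above_add_left)
  assume "g \<in> mono_ideal A"
  then show "f + g \<in> mono_ideal A"
    using f keys_add[of f g] by (auto simp: mono_ideal_def)
qed (simp add: mono_ideal_def)

lemma single_in_ideal:
  fixes J :: "('n, 'k::comm_ring_1) mpoly set"
  assumes J: "ideal J cring_class_ops" and A: "monomial_of ` A \<subseteq> J" and c: "c \<in> above A"
  shows "Poly_Mapping.single c k \<in> J"
proof -
  obtain a where a: "a \<in> A" "\<And>v. Poly_Mapping.lookup a v \<le> Poly_Mapping.lookup c v"
    using c by (auto simp: above_def)
  \<comment> \<open>Subtraction of exponents is truncated; it is exact here because \<open>a\<close>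
    lies below \<open>c\<close> in every component.\<close>
  have "c = (c - a) + a"
    by (rule poly_mapping_eqI) (simp add: lookup_add lookup_minus a(2))
  then have "Poly_Mapping.single c k = Poly_Mapping.single (c - a) k * monomial_of a"
    by (simp add: monomial_of_def mult_single)
  then show ?thesis
    using J A a(1) by (simp add: ideal_class_iff image_subset_iff)
qed

lemma mono_ideal_subset_iff:
  fixes J :: "('n, 'k::comm_ring_1) mpoly set"
  assumes J: "ideal J cring_class_ops"
  shows "mono_ideal A \<subseteq> J \<longleftrightarrow> monomial_of ` A \<subseteq> J"
proof
  have "monomial_of ` A \<subseteq> (mono_ideal A :: ('n, 'k) mpoly set)"
    by (auto intro: aboveI)
  then show "monomial_of ` A \<subseteq> J" if "mono_ideal A \<subseteq> J"
    using that by blast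
  show "mono_ideal A \<subseteq> J" if "monomial_of ` A \<subseteq> J"
  proof
    fix f :: "('n, 'k) mpoly"
    assume "f \<in> mono_ideal A"
    then have "Poly_Mapping.keys f \<subseteq> above A"
      by (simp add: mono_ideal_def)
    then show "f \<in> J"
      by (induction rule: poly_mapping_keys_induct)
         (use J single_in_ideal[OF J that] in \<open>auto simp: ideal_class_iff\<close>)
  qed
qed

lemma Idl_monomials:
  "Idl\<^bsub>cring_class_ops\<^esub> (monomial_of ` A) = (mono_ideal A :: ('n, 'k::comm_ring_1) mpoly set)"
proof (rule antisym)
  show "Idl\<^bsub>cring_class_ops\<^esub> (monomial_of ` A) \<subseteq> (mono_ideal A :: ('n, 'k) mpoly set)"
    by (rule ring.genideal_minimal[OF ring_class ideal_mono_ideal]) (auto intro: aboveI)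
  show "(mono_ideal A :: ('n, 'k) mpoly set) \<subseteq> Idl\<^bsub>cring_class_ops\<^esub> (monomial_of ` A)"
    by (simp add: mono_ideal_subset_iff ideal_Idl_class Idl_class_superset)
qed

section \<open>Products and powers of monomial ideals\<close>

lemma monomial_of_mult: "monomial_of a * monomial_of b = monomial_of (a + b)"
  by (simp add: monomial_of_def mult_single)

text \<open>Multiplying monomials adds exponents, so products of ideals become Minkowski sums of
  exponent sets.\<close>

lemma mono_ideal_prod:
  "mono_ideal A \<cdot>\<^bsub>cring_class_ops\<^esub> mono_ideal B = (mono_ideal (A + B) :: ('n, 'k::comm_ring_1) mpoly set)"
proof (rule antisym)
  show "mono_ideal A \<cdot>\<^bsub>cring_class_ops\<^esub> mono_ideal B \<subseteq> (mono_ideal (A + B) :: ('n, 'k) mpoly set)"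
  proof
    fix s :: "('n, 'k) mpoly"
    assume "s \<in> mono_ideal A \<cdot>\<^bsub>cring_class_ops\<^esub> mono_ideal B"
    then show "s \<in> mono_ideal (A + B)"
    proof (induction rule: ideal_prod.induct)
      case (prod f g)
      then show ?case
        using keys_mult[of f g] above_add by (fastforce simp: mono_ideal_def times_class)
    next
      case (sum f g)
      then show ?case
        using keys_add[of f g] by (auto simp: mono_ideal_def plus_class)
    qed
  qed
  have "monomial_of (a + b) \<in> mono_ideal A \<cdot>\<^bsub>cring_class_ops\<^esub> (mono_ideal B :: ('n, 'k) mpoly set)"
    if "a \<in> A" "b \<in> B" for a b
    using ideal_prod.prod[of "monomial_of a :: ('n, 'k) mpoly" "mono_ideal A" "monomial_of b"
        "mono_ideal B" cring_class_ops] that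
    by (auto simp: times_class monomial_of_mult intro: aboveI)
  then show "(mono_ideal (A + B) :: ('n, 'k) mpoly set) \<subseteq> mono_ideal A \<cdot>\<^bsub>cring_class_ops\<^esub> mono_ideal B"
    by (subst mono_ideal_subset_iff)
       (auto simp: ring.ideal_prod_is_ideal[OF ring_class] ideal_mono_ideal elim: set_plus_elim)
qed

lemma above_zero: "above {0} = UNIV"
  by (auto simp: above_def)

lemma mono_ideal_zero: "mono_ideal {0} = UNIV"
  by (simp add: mono_ideal_def above_zero)

text \<open>The sum is the \<open>n\<close>-fold sumset, with independently chosen summands; for
  \<open>n = 0\<close> it is \<open>{0}\<close>, which gives the unit ideal.\<close>

lemma mono_ideal_pow:
  "(mono_ideal A :: ('n, 'k::comm_ring_1) mpoly set) [^]\<^bsub>ideals_set cring_class_ops\<^esub> (n::nat) =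
     mono_ideal (\<Sum>j<n. A)"
proof (induction n)
  case 0
  then show ?case
    by (simp add: nat_pow_def ideals_set_def mono_ideal_zero cring_class_ops_def)
next
  case (Suc n)
  then show ?case
    using mono_ideal_prod[of "\<Sum>j<n. A" A, where ?'k = 'k]
    by (simp add: nat_pow_def ideals_set_def add.commute)
qed

lemma mono_ideal_finprod:
  "(\<Otimes>\<^bsub>ideals_set cring_class_ops\<^esub> i \<in> {..<n::nat}. mono_ideal (A i) :: ('n, 'k::comm_ring_1) mpoly set) =
     mono_ideal (\<Sum>i<n. A i)"
proof -
  interpret ideals: comm_monoid "ideals_set (cring_class_ops :: ('n, 'k) mpoly ring)"
    by (rule cring.ideals_set_is_comm_monoid[OF cring_class])
  show ?thesis
  proof (induction n)
    case 0
    have "\<one>\<^bsub>ideals_set cring_class_ops\<^esub> = (UNIV :: ('n, 'k) mpoly set)"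
      by (simp add: ideals_set_def cring_class_ops_def)
    then show ?case
      by (simp add: mono_ideal_zero)
  next
    case (Suc n)
    have "(\<lambda>i. mono_ideal (A i) :: ('n, 'k) mpoly set) \<in> X \<rightarrow> carrier (ideals_set cring_class_ops)" for X
      by (auto simp: ideals_set_def ideal_mono_ideal)
    moreover have "(mono_ideal (A n) :: ('n, 'k) mpoly set) \<in> carrier (ideals_set cring_class_ops)"
      by (auto simp: ideals_set_def ideal_mono_ideal)
    ultimately have "(\<Otimes>\<^bsub>ideals_set cring_class_ops\<^esub> i \<in> {..<Suc n}. mono_ideal (A i) :: ('n, 'k) mpoly set) =
        mono_ideal (A n) \<otimes>\<^bsub>ideals_set cring_class_ops\<^esub> mono_ideal (\<Sum>i<n. A i)"
      unfolding lessThan_Suc using Suc by (subst ideals.finprod_insert) auto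
    also have "\<dots> = mono_ideal (\<Sum>i<Suc n. A i)"
      using mono_ideal_prod[of "A n" "\<Sum>i<n. A i", where ?'k = 'k]
      by (simp add: ideals_set_def add.commute)
    finally show ?case .
  qed
qed


section \<open>Frobenius powers and roots\<close>

definition dilate :: "nat \<Rightarrow> ('n \<Rightarrow>\<^sub>0 nat) \<Rightarrow> ('n \<Rightarrow>\<^sub>0 nat)" where
  "dilate q = Poly_Mapping.map ((*) q)"

definition contract :: "nat \<Rightarrow> ('n \<Rightarrow>\<^sub>0 nat) \<Rightarrow> ('n \<Rightarrow>\<^sub>0 nat)" where
  "contract q = Poly_Mapping.map (\<lambda>x. x div q)"

text \<open>Together with \<open>contract\<close> this is division with remainder: a monomial is the
  \<open>q\<close>-th power of its contracted monomial times its residue monomial.\<close>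

definition residue :: "nat \<Rightarrow> ('n \<Rightarrow>\<^sub>0 nat) \<Rightarrow> ('n \<Rightarrow>\<^sub>0 nat)" where
  "residue q = Poly_Mapping.map (\<lambda>x. x mod q)"

lemma lookup_dilate [simp]: "Poly_Mapping.lookup (dilate q a) v = q * Poly_Mapping.lookup a v"
  by (simp add: dilate_def Poly_Mapping.map.rep_eq when_def)

lemma lookup_contract [simp]: "Poly_Mapping.lookup (contract q a) v = Poly_Mapping.lookup a v div q"
  by (simp add: contract_def Poly_Mapping.map.rep_eq when_def)

lemma lookup_residue [simp]: "Poly_Mapping.lookup (residue q a) v = Poly_Mapping.lookup a v mod q"
  by (simp add: residue_def Poly_Mapping.map.rep_eq when_def)

lemma dilate_add: "dilate q (a + b) = dilate q a + dilate q b"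
  by (rule poly_mapping_eqI) (simp add: lookup_add add_mult_distrib2)

lemma dilate_0 [simp]: "dilate q 0 = 0"
  by (rule poly_mapping_eqI) simp

lemma dilate_zero_left [simp]: "dilate 0 a = 0"
  by (rule poly_mapping_eqI) simp

lemma dilate_1 [simp]: "dilate (Suc 0) a = a"
  by (rule poly_mapping_eqI) simp

lemma dilate_dilate: "dilate q (dilate r a) = dilate (q * r) a"
  by (rule poly_mapping_eqI) (simp add: mult.assoc)

lemma dilate_Suc: "dilate (Suc q) a = a + dilate q a"
  by (rule poly_mapping_eqI) (simp add: lookup_add)

lemma dilate_left_add: "dilate (q + r) a = dilate q a + dilate r a"
  by (rule poly_mapping_eqI) (simp add: lookup_add add_mult_distrib)

lemma contract_dilate: "r > 0 \<Longrightarrow> contract (q * r) (dilate r a) = contract q a"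
  by (rule poly_mapping_eqI) (simp add: mult.commute)

lemma contract_dilate_add: "q > 0 \<Longrightarrow> contract q (dilate q a + b) = a + contract q b"
  by (rule poly_mapping_eqI) (simp add: lookup_add)

lemma residue_dilate_add: "residue q (dilate q a + b) = residue q b"
  by (rule poly_mapping_eqI) (simp add: lookup_add)

lemma single_power: "Poly_Mapping.single a c ^ n = Poly_Mapping.single (dilate n a) (c ^ n)"
  for a :: "'n \<Rightarrow>\<^sub>0 nat" and c :: "'k::comm_ring_1"
  by (induction n) (simp_all add: mult_single dilate_Suc)

lemma monomial_of_power: "(monomial_of a :: ('n, 'k::comm_ring_1) mpoly) ^ n = monomial_of (dilate n a)"
  by (simp add: monomial_of_def single_power)

text \<open>Integers embed as constants and are read off from the constant coefficient. This makes
  the freshman's dream available for polynomials.\<close>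

lemma CHAR_mpoly: "CHAR(('n, 'k::comm_ring_1) mpoly) = CHAR('k)"
proof (rule CHAR_eqI)
  have of_nat: "of_nat n = (Poly_Mapping.single 0 (of_nat n) :: ('n, 'k) mpoly)" for n
    by simp
  show "of_nat CHAR('k) = (0 :: ('n, 'k) mpoly)"
    by (subst of_nat) (simp del: single_of_nat)
  show "CHAR('k) dvd n" if "of_nat n = (0 :: ('n, 'k) mpoly)" for n
  proof -
    have "Poly_Mapping.lookup (of_nat n :: ('n, 'k) mpoly) 0 = of_nat n"
      by (simp add: lookup_of_nat)
    then have "of_nat n = (0 :: 'k)"
      unfolding that by simp
    then show ?thesis
      by (simp only: of_nat_eq_0_iff_char_dvd)
  qed
qed

lemma mpoly_frobenius_add:
  fixes f g :: "('n, 'k::comm_ring_1) mpoly"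
  assumes "prime CHAR('k)" "q = CHAR('k) ^ e"
  shows "(f + g) ^ q = f ^ q + g ^ q"
  using assms freshmans_dream'[of q e f g] by (simp add: CHAR_mpoly)

text \<open>The \<open>q\<close>-th power map is additive, so \<open>f ^ q\<close> is the sum of the
  \<open>q\<close>-th powers of the terms of \<open>f\<close>, each a multiple of the
  \<open>q\<close>-th power of a generator.\<close>

lemma frob_power_mono_ideal:
  assumes p: "prime CHAR('k)" and q: "q = CHAR('k) ^ e"
  shows "frob_power q (mono_ideal A :: ('n, 'k::comm_ring_1) mpoly set) = mono_ideal (dilate q ` A)"
proof (rule antisym)
  have q0: "q > 0"
    using p q prime_gt_0_nat by simp
  have "f ^ q \<in> mono_ideal (dilate q ` A)" if "f \<in> mono_ideal A" for f :: "('n, 'k) mpoly"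
  proof -
    from that have "Poly_Mapping.keys f \<subseteq> above A"
      by (simp add: mono_ideal_def)
    then show ?thesis
    proof (induction rule: poly_mapping_keys_induct)
      case zero
      then show ?case
        unfolding zero_power[OF q0] by (simp add: mono_ideal_def)
    next
      case (single a c)
      then have "dilate q a \<in> above (dilate q ` A)"
        unfolding above_def by auto
      then show ?case
        by (simp add: single_power mono_ideal_def)
    next
      case (add f g)
      then show ?case
        using ideal_mono_ideal[of "dilate q ` A", where ?'k = 'k]
        by (simp add: mpoly_frobenius_add[OF p q] ideal_class_iff)
    qed
  qed
  then show "frob_power q (mono_ideal A :: ('n, 'k) mpoly set) \<subseteq> mono_ideal (dilate q ` A)"
    unfolding frob_power_def by (intro ring.genideal_minimal[OF ring_class ideal_mono_ideal] image_subsetI)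
  have "monomial_of (dilate q a) \<in> frob_power q (mono_ideal A :: ('n, 'k) mpoly set)" if "a \<in> A" for a
  proof -
    have "monomial_of a ^ q \<in> (\<lambda>f. f ^ q) ` (mono_ideal A :: ('n, 'k) mpoly set)"
      using that by (intro imageI) (auto intro: aboveI)
    then show ?thesis
      unfolding frob_power_def monomial_of_power by (rule subsetD[OF Idl_class_superset])
  qed
  then show "mono_ideal (dilate q ` A) \<subseteq> frob_power q (mono_ideal A :: ('n, 'k) mpoly set)"
    by (subst mono_ideal_subset_iff) (auto simp add: frob_power_def intro: ideal_Idl_class)
qed

text \<open>\<open>K\<close> is a vector space over itself with scalars acting through the Frobenius map, so that
  \<open>1\<close> extends to a basis.\<close>

lemma frobenius_splitting:
  assumes p: "prime CHAR('k::field)" and q: "q = CHAR('k::field) ^ e"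
  obtains \<psi> :: "'k::field \<Rightarrow> 'k"
    where "\<And>x y. \<psi> (x + y) = \<psi> x + \<psi> y" "\<And>c x. \<psi> (c ^ q * x) = c * \<psi> x" "\<psi> 1 = 1"
proof -
  have add: "(c + d) ^ q = c ^ q + d ^ q" for c d :: 'k
    by (rule freshmans_dream'[OF p q])
  have "vector_space (\<lambda>c x. c ^ q * x :: 'k)"
    by (rule vector_space.intro) (simp_all add: add power_mult_distrib mult.assoc distrib_left distrib_right)
  moreover have "vector_space ((*) :: 'k \<Rightarrow> 'k \<Rightarrow> 'k)"
    by (rule vector_space.intro) (simp_all add: mult.assoc distrib_left distrib_right)
  ultimately interpret vector_space_pair "\<lambda>c x. c ^ q * x :: 'k" "(*) :: 'k \<Rightarrow> 'k \<Rightarrow> 'k"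
    by (rule vector_space_pair.intro)
  have "vs1.independent {1}"
    by (simp only: vs1.dependent_single one_neq_zero not_False_eq_True)
  from linear_independent_extend[OF this, of id] obtain \<psi> :: "'k \<Rightarrow> 'k"
    where \<psi>: "Vector_Spaces.linear (\<lambda>c x. c ^ q * x) (*) \<psi>" and \<psi>_1: "\<psi> 1 = 1"
    by auto
  interpret \<psi>: Vector_Spaces.linear "\<lambda>c x. c ^ q * x" "(*)" \<psi>
    by (rule \<psi>)
  show ?thesis
    by (rule that[OF \<psi>.add \<psi>.scale \<psi>_1])
qed

text \<open>A map \<open>\<tau>\<close> with \<open>\<tau> (g ^ q * h) = g * \<tau> h\<close> sends
  the Frobenius power of \<open>L\<close> back into \<open>L\<close>; it is built so that
  \<open>monomial_of a\<close> goes to the contracted monomial.\<close>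

lemma contract_in_ideal:
  fixes L :: "('n, 'k::field) mpoly set"
  assumes p: "prime CHAR('k)" and q: "q = CHAR('k) ^ e"
    and L: "ideal L cring_class_ops" and a: "monomial_of a \<in> frob_power q L"
  shows "monomial_of (contract q a) \<in> L"
proof -
  have q0: "q > 0"
    using p q prime_gt_0_nat by simp
  obtain \<psi> :: "'k \<Rightarrow> 'k" where \<psi>_add: "\<And>x y. \<psi> (x + y) = \<psi> x + \<psi> y"
    and \<psi>_mult: "\<And>c x. \<psi> (c ^ q * x) = c * \<psi> x" and \<psi>_1: "\<psi> 1 = 1"
    using frobenius_splitting[OF p q] by blast
  have \<psi>_0: "\<psi> 0 = 0"
    using \<psi>_mult[of 0 1] q0 by (simp add: zero_power)
  \<comment> \<open>Only terms with exponents congruent to \<open>a\<close> modulo \<open>q\<close>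
    survive; their exponents are divided by \<open>q\<close> and \<open>\<psi>\<close> extracts a
    \<open>q\<close>-th root part of the coefficient, fixing 1.\<close>
  define \<tau>1 where "\<tau>1 b c =
    (if residue q b = residue q a then Poly_Mapping.single (contract q b) (\<psi> c) else 0)"
    for b :: "'n \<Rightarrow>\<^sub>0 nat" and c
  \<comment> \<open>The support can shrink when polynomials are added; zero coefficients must
    contribute nothing for \<open>\<tau>\<close> to be additive.\<close>
  have \<tau>1_0: "\<tau>1 b 0 = 0" for b
    by (simp add: \<tau>1_def \<psi>_0)
  have \<tau>1_add: "\<tau>1 b (c + d) = \<tau>1 b c + \<tau>1 b d" for b c d
    by (simp add: \<tau>1_def \<psi>_add single_add)
  define \<tau> :: "('n, 'k) mpoly \<Rightarrow> ('n, 'k) mpoly"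
    where "\<tau> f = (\<Sum>b\<in>Poly_Mapping.keys f. \<tau>1 b (Poly_Mapping.lookup f b))" for f
  have \<tau>_single: "\<tau> (Poly_Mapping.single b c) = \<tau>1 b c" for b c
    by (simp add: \<tau>_def \<tau>1_0)
  have \<tau>_add: "\<tau> (f + g) = \<tau> f + \<tau> g" for f g
    unfolding \<tau>_def by (rule setsum_keys_plus_distrib) (simp_all add: \<tau>1_0 \<tau>1_add)
  have \<tau>_0: "\<tau> 0 = 0"
    by (simp add: \<tau>_def)
  \<comment> \<open>For a single term \<open>g\<close>, multiplying by \<open>g ^ q\<close> leaves
    residues unchanged and shifts the contracted exponent by that of \<open>g\<close>; additivity of
    the \<open>q\<close>-th power does the rest.\<close>
  have \<tau>_power_mult_single: "\<tau> (g ^ q * Poly_Mapping.single b c) = g * \<tau>1 b c" for g b c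
    using subset_UNIV[of "Poly_Mapping.keys g"]
  proof (induction rule: poly_mapping_keys_induct)
    case (single b' c')
    then show ?case
      by (simp add: single_power mult_single \<tau>_single \<tau>1_def residue_dilate_add
          contract_dilate_add[OF q0] \<psi>_mult)
  next
    case (add f g)
    then show ?case
      by (simp add: mpoly_frobenius_add[OF p q] distrib_right \<tau>_add)
  qed (simp add: zero_power[OF q0] \<tau>_0)
  have \<tau>_power_mult: "\<tau> (g ^ q * h) = g * \<tau> h" for g h
    using subset_UNIV[of "Poly_Mapping.keys h"]
    by (induction rule: poly_mapping_keys_induct)
       (simp_all add: \<tau>_0 \<tau>_power_mult_single \<tau>_single \<tau>_add distrib_left)
  \<comment> \<open>Quantifying over all multipliers \<open>h\<close> makes \<open>J\<close> an
    ideal, so only the generators \<open>f ^ q\<close> need testing; \<open>h = 1\<close> gives the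
    claim.\<close>
  define J where "J = {f. \<forall>h. \<tau> (f * h) \<in> L}"
  have "ideal J cring_class_ops"
    using L by (simp add: J_def ideal_class_iff \<tau>_0 \<tau>_add distrib_right mult.assoc mult.left_commute)
  moreover have "(\<lambda>f. f ^ q) ` L \<subseteq> J"
    using L by (auto simp: J_def \<tau>_power_mult ideal_class_iff mult.commute[of _ "\<tau> _"])
  ultimately have "frob_power q L \<subseteq> J"
    unfolding frob_power_def by (rule ring.genideal_minimal[OF ring_class])
  then have "\<tau> (monomial_of a * 1) \<in> L"
    using a unfolding J_def by blast
  then show ?thesis
    by (simp add: monomial_of_def \<tau>_single \<tau>1_def \<psi>_1)
qed

text \<open>Rounding down and scaling back by \<open>q\<close> never exceeds the original exponent,
  so the contracted ideal is admissible; \<open>contract_in_ideal\<close> makes it the least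
  one.\<close>

lemma frob_root_mono_ideal:
  assumes p: "prime CHAR('k)" and q: "q = CHAR('k) ^ e"
  shows "frob_root q (mono_ideal A :: ('n, 'k::field) mpoly set) = mono_ideal (contract q ` A)"
  unfolding frob_root_def
proof (rule Least_equality, intro conjI)
  have "a \<in> above (dilate q ` contract q ` A)" if "a \<in> A" for a
    using that by (intro aboveI[of "dilate q (contract q a)"]) auto
  then show "mono_ideal A \<subseteq> frob_power q (mono_ideal (contract q ` A) :: ('n, 'k) mpoly set)"
    unfolding frob_power_mono_ideal[OF p q] by (intro mono_ideal_mono) auto
next
  fix L :: "('n, 'k) mpoly set"
  assume L: "ideal L cring_class_ops \<and> mono_ideal A \<subseteq> frob_power q L"
  have "monomial_of (contract q a) \<in> L" if "a \<in> A" for a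
  proof -
    have "(monomial_of a :: ('n, 'k) mpoly) \<in> mono_ideal A"
      using that by (auto intro: aboveI)
    then show ?thesis
      using L contract_in_ideal[OF p q] by blast
  qed
  then show "mono_ideal (contract q ` A) \<subseteq> L"
    using L by (subst mono_ideal_subset_iff) auto
qed (rule ideal_mono_ideal)


section \<open>Digit powers of monomial ideals\<close>

text \<open>Exponents of the generators of \<open>I^[k]\<close>: each base \<open>p\<close> digit of
  \<open>k\<close> counts freely chosen elements of \<open>A\<close>, whose sum is scaled by the
  place value.\<close>

definition digit_exponents :: "nat \<Rightarrow> ('n \<Rightarrow>\<^sub>0 nat) set \<Rightarrow> nat \<Rightarrow> ('n \<Rightarrow>\<^sub>0 nat) set" where
  "digit_exponents p A k = (\<Sum>i<floorlog p k. dilate (p ^ i) ` (\<Sum>j<k div p ^ i mod p. A))"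

lemma digit_power_mono_ideal:
  assumes "prime CHAR('k)"
  shows "digit_power CHAR('k) (mono_ideal A :: ('n, 'k::comm_ring_1) mpoly set) k =
           mono_ideal (digit_exponents CHAR('k) A k)"
  unfolding digit_power_def digit_exponents_def
  by (simp only: mono_ideal_pow frob_power_mono_ideal[OF assms refl] mono_ideal_finprod)

lemma digit_power_frac_mono_ideal:
  assumes "prime CHAR('k)"
  shows "digit_power_frac CHAR('k) (mono_ideal A :: ('n, 'k::field) mpoly set) k e =
           mono_ideal (contract (CHAR('k) ^ e) ` digit_exponents CHAR('k) A k)"
  by (simp add: digit_power_frac_def digit_power_mono_ideal[OF assms] frob_root_mono_ideal[OF assms refl])

lemma image_dilate_plus: "dilate q ` (A + B) = dilate q ` A + dilate q ` B"
proof (intro equalityI subsetI)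
  fix c
  assume "c \<in> dilate q ` (A + B)"
  then obtain a b where "a \<in> A" "b \<in> B" "c = dilate q a + dilate q b"
    by (auto simp: dilate_add elim!: set_plus_elim)
  then show "c \<in> dilate q ` A + dilate q ` B"
    by blast
next
  fix c
  assume "c \<in> dilate q ` A + dilate q ` B"
  then obtain a b where "a \<in> A" "b \<in> B" "c = dilate q (a + b)"
    by (auto simp: dilate_add elim!: set_plus_elim)
  then show "c \<in> dilate q ` (A + B)"
    by blast
qed

lemma image_dilate_sum: "dilate q ` (\<Sum>i\<in>B. A i) = (\<Sum>i\<in>B. dilate q ` A i)"
  by (induction B rule: infinite_finite_induct) (simp_all add: image_dilate_plus)

lemma digit_exponents_0 [simp]: "digit_exponents p A 0 = {0}"
  by (simp add: digit_exponents_def floorlog_def)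

text \<open>Splitting off the lowest digit, as in Horner's scheme; the basis for inductions through
  \<open>k div p\<close>.\<close>

lemma digit_exponents_rec:
  assumes "p > 1"
  shows "digit_exponents p A k = (\<Sum>j<k mod p. A) + dilate p ` digit_exponents p A (k div p)"
proof (cases "k = 0")
  case False
  then have len: "floorlog p k = Suc (floorlog p (k div p))"
    using assms compute_floorlog[of p k] by simp
  show ?thesis
    unfolding digit_exponents_def len sum.lessThan_Suc_shift image_dilate_sum
    by (simp add: image_image dilate_dilate div_mult2_eq)
qed simp

lemma dilate_in_sumset: "a \<in> A \<Longrightarrow> dilate n a \<in> (\<Sum>j<n. A)"
  by (induction n) (auto simp: dilate_Suc add.commute)

text \<open>Without a carry, one more summand joins the lowest digit and equality holds. A carry is
  handled by induction on the higher digits and gives only an inclusion.\<close>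

lemma digit_exponents_Suc:
  assumes p: "p > 1"
  shows "digit_exponents p A (Suc k) \<subseteq> A + digit_exponents p A k"
proof (induction k rule: less_induct)
  case (less k)
  note rec = digit_exponents_rec[OF p, of A]
  show ?case
  proof (cases "Suc (k mod p) = p")
    case False
    then have "digit_exponents p A (Suc k) = (A + (\<Sum>j<k mod p. A)) + dilate p ` digit_exponents p A (k div p)"
      by (subst rec) (simp add: mod_Suc div_Suc add.commute)
    also have "\<dots> = A + digit_exponents p A k"
      by (simp add: rec[of k] add.assoc)
    finally show ?thesis
      by simp
  next
    case True
    have "k > 0"
      using True p by (intro gr0I) auto
    then have IH: "digit_exponents p A (Suc (k div p)) \<subseteq> A + digit_exponents p A (k div p)"
      using p by (intro less.IH div_less_dividend) auto
    have "(\<Sum>j<p. A) = A + (\<Sum>j<k mod p. A)"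
      using True by (metis add.commute sum.lessThan_Suc)
    \<comment> \<open>The carry produces \<open>p\<close> copies of one element: one copy becomes
      the new summand, the other \<open>p - 1\<close> fill the lowest digit of
      \<open>k\<close>.\<close>
    then have A: "dilate p ` A \<subseteq> A + (\<Sum>j<k mod p. A)"
      using dilate_in_sumset[of _ A p] by blast
    have "digit_exponents p A (Suc k) = dilate p ` digit_exponents p A (Suc (k div p))"
      using True by (subst rec) (simp add: mod_Suc div_Suc)
    also have "\<dots> \<subseteq> dilate p ` A + dilate p ` digit_exponents p A (k div p)"
      using IH by (simp add: image_mono flip: image_dilate_plus)
    also have "\<dots> \<subseteq> (A + (\<Sum>j<k mod p. A)) + dilate p ` digit_exponents p A (k div p)"
      by (rule set_plus_mono2[OF A subset_refl])
    also have "\<dots> = A + digit_exponents p A k"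
      by (simp add: rec[of k] add.assoc)
    finally show ?thesis .
  qed
qed

text \<open>The counterpart of \<open>I^[k] \<subseteq> I^k\<close>, by adding one summand at a
  time.\<close>

lemma digit_exponents_subset_sumset:
  assumes "p > 1"
  shows "digit_exponents p A k \<subseteq> (\<Sum>j<k. A)"
proof (induction k)
  case (Suc k)
  have "digit_exponents p A (Suc k) \<subseteq> A + (\<Sum>j<k. A)"
    using digit_exponents_Suc[OF assms, of A k] set_plus_mono2[OF subset_refl Suc] by (rule subset_trans)
  then show ?case
    by (simp add: add.commute)
qed simp

text \<open>Choosing the same \<open>a\<close> for every digit, the scaled digits add up to
  \<open>k\<close>.\<close>

lemma dilate_in_digit_exponents:
  assumes p: "p > 1" and a: "a \<in> A"
  shows "dilate k a \<in> digit_exponents p A k"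
proof (induction k rule: less_induct)
  case (less k)
  show ?case
  proof (cases "k = 0")
    case False
    then have "dilate (k div p) a \<in> digit_exponents p A (k div p)"
      using p by (intro less) auto
    then have "dilate (k mod p) a + dilate p (dilate (k div p) a) \<in> digit_exponents p A k"
      unfolding digit_exponents_rec[OF p, of A k] by (intro set_plus_intro imageI dilate_in_sumset a)
    then show ?thesis
      by (simp add: dilate_dilate flip: dilate_left_add)
  qed simp
qed

lemma sumset_lookup_le:
  assumes "b \<in> (\<Sum>j<n::nat. A)" "\<And>a. a \<in> A \<Longrightarrow> Poly_Mapping.lookup a v \<le> D"
  shows "Poly_Mapping.lookup b v \<le> n * D"
  using assms(1)
proof (induction n arbitrary: b)
  case (Suc n)
  then obtain c a where "b = c + a" "c \<in> (\<Sum>j<n. A)" "a \<in> A"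
    by (auto elim: set_plus_elim)
  then show ?case
    using Suc.IH[of c] assms(2)[of a] by (simp add: lookup_add)
qed simp

lemma sumset_lookup_ge:
  assumes "b \<in> (\<Sum>j<n::nat. A)" "\<And>a. a \<in> A \<Longrightarrow> D \<le> Poly_Mapping.lookup a v"
  shows "n * D \<le> Poly_Mapping.lookup b v"
  using assms(1)
proof (induction n arbitrary: b)
  case (Suc n)
  then obtain c a where "b = c + a" "c \<in> (\<Sum>j<n. A)" "a \<in> A"
    by (auto elim: set_plus_elim)
  then show ?case
    using Suc.IH[of c] assms(2)[of a] by (simp add: lookup_add)
qed simp

text \<open>Raising \<open>k\<close> by one adds a further summand from \<open>A\<close>, which can
  only increase exponents.\<close>

lemma digit_exponents_antimono:
  assumes "p > 1" "k \<le> k'"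
  shows "digit_exponents p A k' \<subseteq> above (digit_exponents p A k)"
  using assms(2)
proof (induction k' rule: dec_induct)
  case base
  then show ?case
    by (auto intro: aboveI)
next
  case (step m)
  have "A + digit_exponents p A m \<subseteq> above (digit_exponents p A m)"
    by (auto elim!: set_plus_elim intro: aboveI simp: lookup_add)
  then have "digit_exponents p A (Suc m) \<subseteq> above (digit_exponents p A m)"
    using digit_exponents_Suc[OF assms(1), of A m] by (rule subset_trans[rotated])
  also have "\<dots> \<subseteq> above (digit_exponents p A k)"
    using step.IH by (simp add: above_subset_iff)
  finally show ?case .
qed

text \<open>Multiplying \<open>k\<close> by a power of \<open>p\<close> shifts its digits and
  appends zeros.\<close>

lemma digit_exponents_power_mult:
  assumes "p > 1"
  shows "digit_exponents p A (p ^ n * k) = dilate (p ^ n) ` digit_exponents p A k"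
proof (induction n)
  case (Suc n)
  have "digit_exponents p A (p ^ Suc n * k) = dilate p ` digit_exponents p A (p ^ n * k)"
    using assms by (subst digit_exponents_rec) (simp_all add: mult.assoc)
  then show ?case
    by (simp add: Suc image_image dilate_dilate)
qed simp

text \<open>Independence of the representation: \<open>k / p ^ e\<close> may be expanded by
  \<open>p ^ n\<close>.\<close>

lemma contract_digit_exponents:
  assumes "p > 1"
  shows "contract (p ^ e) ` digit_exponents p A k = contract (p ^ (e + n)) ` digit_exponents p A (p ^ n * k)"
  using assms by (simp add: digit_exponents_power_mult image_image power_add contract_dilate)

lemma contract_above: "c \<in> above B \<Longrightarrow> contract q c \<in> above (contract q ` B)"
  unfolding above_def by (auto intro!: div_le_mono)

text \<open>The assumption is \<open>k / p ^ e \<le> k' / p ^ e'\<close> with denominators cleared;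
  both fractions are expanded to the denominator \<open>p ^ (e + e')\<close> and the numerators
  compared.\<close>

lemma mono_ideal_contract_antimono:
  assumes p: "p > 1" and le: "k * p ^ e' \<le> k' * p ^ e"
  shows "mono_ideal (contract (p ^ e') ` digit_exponents p A k') \<subseteq>
         mono_ideal (contract (p ^ e) ` digit_exponents p A k)"
proof (rule mono_ideal_mono, safe)
  fix c
  assume "c \<in> digit_exponents p A k'"
  then have "contract (p ^ e') c \<in> contract (p ^ (e' + e)) ` digit_exponents p A (p ^ e * k')"
    by (simp flip: contract_digit_exponents[OF p])
  moreover have "digit_exponents p A (p ^ e * k') \<subseteq> above (digit_exponents p A (p ^ e' * k))"
    using le by (intro digit_exponents_antimono[OF p]) (simp add: mult.commute)
  ultimately have "contract (p ^ e') c \<in> above (contract (p ^ (e + e')) ` digit_exponents p A (p ^ e' * k))"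
    using contract_above by (fastforce simp: add.commute)
  then show "contract (p ^ e') c \<in> above (contract (p ^ e) ` digit_exponents p A k)"
    by (simp flip: contract_digit_exponents[OF p])
qed


section \<open>The least critical exponent\<close>

text \<open>Being constant on an interval to the right of \<open>l\<close> settles every admissible
  sequence. Uniqueness for \<open>THE\<close> also needs one such sequence to exist, since otherwise
  any set would qualify vacuously.\<close>

lemma digit_power_real_eqI:
  assumes p: "p > 1" and l: "l \<ge> 0" and "\<epsilon> > 0"
    and A: "\<And>k e. l < real k / real (p ^ e) \<Longrightarrow> real k / real (p ^ e) < l + \<epsilon> \<Longrightarrow>
              digit_power_frac p I k e = A"
  shows "digit_power_real p I l = A"
  unfolding digit_power_real_def
proof (rule the_equality, intro allI impI)
  fix k e :: "nat \<Rightarrow> nat"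
  assume ke: "decseq (\<lambda>j. real (k j) / real (p ^ e j)) \<and>
     (\<forall>j. l < real (k j) / real (p ^ e j)) \<and> (\<lambda>j. real (k j) / real (p ^ e j)) \<longlonglongrightarrow> l"
  then have "\<forall>\<^sub>F j in sequentially. real (k j) / real (p ^ e j) < l + \<epsilon>"
    using \<open>\<epsilon> > 0\<close> by (intro order_tendstoD(2)) auto
  then show "\<forall>\<^sub>F j in sequentially. digit_power_frac p I (k j) (e j) = A"
    by (rule eventually_mono) (use A ke in blast)
next
  fix B
  assume B: "\<forall>k e :: nat \<Rightarrow> nat. decseq (\<lambda>j. real (k j) / real (p ^ e j)) \<and>
     (\<forall>j. l < real (k j) / real (p ^ e j)) \<and> (\<lambda>j. real (k j) / real (p ^ e j)) \<longlonglongrightarrow> l \<longrightarrow>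
     (\<forall>\<^sub>F j in sequentially. digit_power_frac p I (k j) (e j) = B)"
  \<comment> \<open>The least numerator putting the fraction with denominator \<open>p ^ j\<close>
    strictly above \<open>l\<close>; it overshoots by at most \<open>1 / p ^ j\<close>.\<close>
  define k where "k j = Suc (nat \<lfloor>l * real (p ^ j)\<rfloor>)" for j
  let ?x = "\<lambda>j. real (k j) / real (p ^ j)"
  have pj: "real (p ^ j) > 0" for j
    using p by simp
  have k_int: "int (k j) = \<lfloor>l * real (p ^ j)\<rfloor> + 1" for j
    using l by (simp add: k_def)
  then have k: "real (k j) = of_int \<lfloor>l * real (p ^ j)\<rfloor> + 1" for j
    by (metis of_int_1 of_int_add of_int_of_nat_eq)
  have lower: "l < ?x j" for j
    using pj[of j] floor_correct[of "l * real (p ^ j)"] unfolding k by (simp only: pos_less_divide_eq) simp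
  have upper: "?x j \<le> l + 1 / real (p ^ j)" for j
  proof -
    have "?x j \<le> (l * real (p ^ j) + 1) / real (p ^ j)"
      unfolding k using floor_correct[of "l * real (p ^ j)"] by (intro divide_right_mono) simp_all
    also have "\<dots> = l + 1 / real (p ^ j)"
      using pj[of j] by (simp only: add_divide_distrib) simp
    finally show ?thesis .
  qed
  have "?x (Suc j) \<le> ?x j" for j
  proof -
    \<comment> \<open>\<open>p * k j\<close> is also a valid numerator at the next level, so the
      least one there does not exceed it.\<close>
    have "l * real (p ^ Suc j) < real (p * k j)"
      using lower[of j] pj[of j] p by (simp add: pos_less_divide_eq mult.left_commute)
    then have "\<lfloor>l * real (p ^ Suc j)\<rfloor> < int (p * k j)"
      by (simp only: floor_less_iff of_int_of_nat_eq)
    then have "int (k (Suc j)) \<le> int (p * k j)"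
      unfolding k_int by simp
    then have "real (k (Suc j)) \<le> real p * real (k j)"
      by (metis of_nat_le_iff of_nat_mult)
    then show ?thesis
      using p by (simp add: divide_simps mult.commute mult.left_commute)
  qed
  then have "decseq ?x"
    by (rule decseq_SucI)
  moreover have "?x \<longlonglongrightarrow> l"
  proof (rule tendsto_sandwich[OF _ _ tendsto_const])
    have "(\<lambda>j. (1 / real p) ^ j) \<longlonglongrightarrow> 0"
      using p by (intro LIMSEQ_realpow_zero) simp_all
    then have "(\<lambda>j. l + (1 / real p) ^ j) \<longlonglongrightarrow> l + 0"
      by (intro tendsto_add tendsto_const)
    then show "(\<lambda>j. l + 1 / real (p ^ j)) \<longlonglongrightarrow> l"
      by (simp add: power_divide)
  qed (use lower upper in \<open>auto intro!: always_eventually less_imp_le\<close>)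
  ultimately have lim: "decseq ?x \<and> (\<forall>j. l < ?x j) \<and> ?x \<longlonglongrightarrow> l"
    using lower by blast
  then have "\<forall>\<^sub>F j in sequentially. digit_power_frac p I (k j) j = B"
    by (rule B[THEN spec[of _ k], THEN spec[of _ "\<lambda>j. j"], THEN mp])
  moreover have "\<forall>\<^sub>F j in sequentially. ?x j < l + \<epsilon>"
    using lim \<open>\<epsilon> > 0\<close> by (intro order_tendstoD(2)) auto
  ultimately have "\<forall>\<^sub>F j in sequentially. B = A"
    by eventually_elim (use A lower in blast)
  then show "B = A"
    by simp
qed

lemma finite_bounded_exponents: "finite {c :: 'n::finite \<Rightarrow>\<^sub>0 nat. \<forall>v. Poly_Mapping.lookup c v \<le> N}"
    (is "finite ?S")
proof (rule finite_imageD)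
  have "Poly_Mapping.lookup ` ?S \<subseteq> PiE UNIV (\<lambda>_. {..N})"
    by auto
  then show "finite (Poly_Mapping.lookup ` ?S)"
    by (rule finite_subset) (intro finite_PiE finite_UNIV finite_atMost)
  show "inj_on Poly_Mapping.lookup ?S"
    by (intro inj_onI) (simp only: poly_mapping_eq_iff)
qed

text \<open>The hypotheses on exponents: \<open>a\<close> belongs to the \<open>d\<close>-th power
  of a squarefree monomial, and \<open>x\<close> occurs at least \<open>d\<close> times in each
  generator. The value is the unit ideal below \<open>1 / d\<close> and a proper ideal at
  \<open>1 / d\<close>.\<close>

lemma lce_mono_ideal:
  fixes A :: "('n::finite \<Rightarrow>\<^sub>0 nat) set"
  assumes prime: "prime CHAR('k)" and fin: "finite A" and d: "d > 0"
    and a: "a \<in> A" "\<And>v. Poly_Mapping.lookup a v \<le> d"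
    and A: "\<And>b. b \<in> A \<Longrightarrow> d \<le> Poly_Mapping.lookup b x"
  shows "lce CHAR('k) (mono_ideal A :: ('n, 'k::field) mpoly set) = 1 / real d"
proof -
  define p where "p = CHAR('k)"
  define I :: "('n, 'k) mpoly set" where "I = mono_ideal A"
  define B where "B k e = contract (p ^ e) ` digit_exponents p A k" for k e
  have p: "p > 1"
    using prime prime_gt_1_nat p_def by blast
  have frac: "digit_power_frac p I k e = mono_ideal (B k e)" for k e
    unfolding I_def p_def B_def by (rule digit_power_frac_mono_ideal[OF prime])
  have pe: "p ^ e > 0" for e
    using p by simp
  have less_iff: "real k / real (p ^ e) < 1 / real d \<longleftrightarrow> k * d < p ^ e"
    and greater_iff: "1 / real d < real k / real (p ^ e) \<longleftrightarrow> p ^ e < k * d" for k e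
  proof -
    have "real k / real (p ^ e) < 1 / real d \<longleftrightarrow> real (k * d) < real (p ^ e)"
      using d p by (simp add: divide_simps)
    then show "real k / real (p ^ e) < 1 / real d \<longleftrightarrow> k * d < p ^ e"
      by (simp only: of_nat_less_iff)
    have "1 / real d < real k / real (p ^ e) \<longleftrightarrow> real (p ^ e) < real (k * d)"
      using d p by (simp add: divide_simps)
    then show "1 / real d < real k / real (p ^ e) \<longleftrightarrow> p ^ e < k * d"
      by (simp only: of_nat_less_iff)
  qed
  have unit: "digit_power_frac p I k e = UNIV" if "k * d < p ^ e" for k e
  proof -
    have "k * Poly_Mapping.lookup a v < p ^ e" for v
      using a(2)[of v] that by (meson le_less_trans mult_le_mono2)
    then have "contract (p ^ e) (dilate k a) = 0"
      by (intro poly_mapping_eqI) simp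
    then have "0 \<in> B k e"
      using dilate_in_digit_exponents[OF p a(1), of k] unfolding B_def by force
    then have "UNIV \<subseteq> above (B k e)"
      unfolding above_zero[symmetric] above_subset_iff by (auto intro: aboveI)
    then show ?thesis
      by (auto simp: frac mono_ideal_def)
  qed
  have proper: "digit_power_frac p I k e \<noteq> UNIV" if "p ^ e < k * d" for k e
  proof -
    have "Poly_Mapping.lookup b x > 0" if b: "b \<in> B k e" for b
    proof -
      obtain c where c: "c \<in> digit_exponents p A k" "b = contract (p ^ e) c"
        using b by (auto simp: B_def)
      then have "c \<in> (\<Sum>j<k. A)"
        using digit_exponents_subset_sumset[OF p] by blast
      then have "k * d \<le> Poly_Mapping.lookup c x"
        by (rule sumset_lookup_ge) (rule A)
      then have "p ^ e \<le> Poly_Mapping.lookup c x"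
        using \<open>p ^ e < k * d\<close> by simp
      then show ?thesis
        using c(2) pe[of e] by (simp add: div_greater_zero_iff)
    qed
    then have "0 \<notin> above (B k e)"
      by (force simp: above_def)
    then have "monomial_of 0 \<notin> digit_power_frac p I k e"
      by (simp add: frac)
    then show ?thesis
      by blast
  qed
  \<comment> \<open>With \<open>\<epsilon>\<close> the distance from \<open>u\<close> to
    \<open>1 / d\<close>, all fractions considered stay below \<open>1 / d\<close>.\<close>
  have unit_real: "digit_power_real p I u = UNIV" if "0 \<le> u" "u < 1 / real d" for u
    by (rule digit_power_real_eqI[where \<epsilon> = "1 / real d - u", OF p])
       (use that unit less_iff in auto)
  have proper_real: "digit_power_real p I (1 / real d) \<noteq> UNIV"
  proof -
    \<comment> \<open>The values at fractions above \<open>1 / d\<close>; the cap 2 bounds the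
      exponents and, exceeding \<open>1 / d\<close>, is itself such a fraction.\<close>
    define F where "F = {digit_power_frac p I k e |k e. p ^ e < k * d \<and> k \<le> 2 * p ^ e}"
    obtain D where D: "Poly_Mapping.lookup b v \<le> D" if "b \<in> A" for b v
    proof
      have "finite ((\<lambda>(b, v). Poly_Mapping.lookup b v) ` (A \<times> UNIV))"
        using fin by simp
      then show "Poly_Mapping.lookup b v \<le> Max ((\<lambda>(b, v). Poly_Mapping.lookup b v) ` (A \<times> UNIV))"
        if "b \<in> A" for b v
        using that by (intro Max_ge) auto
    qed
    \<comment> \<open>At most \<open>2 * p ^ e\<close> summands with entries at most
      \<open>D\<close>, divided by \<open>p ^ e\<close>.\<close>
    have "B k e \<subseteq> {c. \<forall>v. Poly_Mapping.lookup c v \<le> 2 * D}" if k: "k \<le> 2 * p ^ e" for k e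
    proof safe
      fix b v
      assume "b \<in> B k e"
      then obtain c where c: "c \<in> digit_exponents p A k" "b = contract (p ^ e) c"
        by (auto simp: B_def)
      then have "c \<in> (\<Sum>j<k. A)"
        using digit_exponents_subset_sumset[OF p] by blast
      then have "Poly_Mapping.lookup c v \<le> k * D"
        by (rule sumset_lookup_le) (rule D)
      also have "\<dots> \<le> p ^ e * (2 * D)"
        using k mult_le_mono1[OF k, of D] by (simp add: mult_ac)
      finally have "Poly_Mapping.lookup c v div p ^ e \<le> p ^ e * (2 * D) div p ^ e"
        by (rule div_le_mono)
      then show "Poly_Mapping.lookup b v \<le> 2 * D"
        by (simp only: c(2) lookup_contract nonzero_mult_div_cancel_left[OF gr_implies_not0[OF pe]])
    qed
    then have "F \<subseteq> mono_ideal ` Pow {c. \<forall>v. Poly_Mapping.lookup c v \<le> 2 * D}"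
      by (auto simp: F_def frac)
    then have "finite F"
      by (rule finite_subset) (simp add: finite_bounded_exponents)
    moreover have "digit_power_frac p I 2 0 \<in> F"
      unfolding F_def mem_Collect_eq using d by (intro exI[of _ 2] exI[of _ 0]) simp
    ultimately obtain X where X: "X \<in> F" and X_max: "\<And>Y. Y \<in> F \<Longrightarrow> X \<subseteq> Y \<Longrightarrow> X = Y"
      using finite_has_maximal[of F] by blast
    from X obtain k0 e0 where X_eq: "X = digit_power_frac p I k0 e0"
      and k0: "p ^ e0 < k0 * d" "k0 \<le> 2 * p ^ e0"
      by (auto simp: F_def)
    \<comment> \<open>\<open>\<epsilon>\<close> is chosen to end the interval at
      \<open>k0 / p ^ e0\<close>, where the maximal \<open>X\<close> is attained. Fractions inside
      it give values containing \<open>X\<close> by antitonicity, hence equal to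
      \<open>X\<close>.\<close>
    have "digit_power_real p I (1 / real d) = X"
    proof (rule digit_power_real_eqI[OF p])
      show "0 < real k0 / real (p ^ e0) - 1 / real d"
        using k0(1) greater_iff[of k0 e0] by simp
    next
      fix k e
      assume k: "1 / real d < real k / real (p ^ e)"
        "real k / real (p ^ e) < 1 / real d + (real k0 / real (p ^ e0) - 1 / real d)"
      from k(2) have "real k / real (p ^ e) < real k0 / real (p ^ e0)"
        by simp
      then have "real (k * p ^ e0) < real (k0 * p ^ e)"
        using p by (simp add: divide_simps)
      then have less: "k * p ^ e0 < k0 * p ^ e"
        by (simp only: of_nat_less_iff)
      also have "\<dots> \<le> (2 * p ^ e) * p ^ e0"
        using mult_le_mono1[OF k0(2), of "p ^ e"] by (simp add: mult_ac)
      finally have "k \<le> 2 * p ^ e"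
        using pe[of e0] by simp
      then have "digit_power_frac p I k e \<in> F"
        using k(1) greater_iff[of k e] by (auto simp: F_def)
      moreover have "X \<subseteq> digit_power_frac p I k e"
        unfolding X_eq frac B_def using less by (intro mono_ideal_contract_antimono[OF p]) simp
      ultimately show "digit_power_frac p I k e = X"
        using X_max by blast
    qed simp
    then show ?thesis
      using proper[OF k0(1)] X_eq by simp
  qed
  have "lce p I = 1 / real d"
    unfolding lce_def
  proof (rule Least_equality)
    show "critical_exponent p I (1 / real d)"
      using d unit_real proper_real by (simp add: critical_exponent_def)
    show "1 / real d \<le> l" if "critical_exponent p I l" for l
    proof (rule ccontr)
      assume "\<not> 1 / real d \<le> l"
      \<comment> \<open>The comparison point \<open>u = 0\<close> refutes criticality: both values
        are the unit ideal.\<close>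
      then have "digit_power_real p I 0 = digit_power_real p I l"
        using that unit_real d by (simp add: critical_exponent_def)
      then show False
        using that by (simp add: critical_exponent_def)
    qed
  qed
  then show ?thesis
    by (simp add: p_def I_def)
qed

section \<open>Divisibility and squarefreeness of monomials\<close>

lemma variable_dvd_monomial_of_iff:
  "(variable v :: ('n, 'k::comm_ring_1) mpoly) dvd monomial_of a \<longleftrightarrow> Poly_Mapping.lookup a v > 0"
proof
  assume "(variable v :: ('n, 'k) mpoly) dvd monomial_of a"
  then obtain h :: "('n, 'k) mpoly" where h: "monomial_of a = variable v * h" ..
  have "(variable v :: ('n, 'k) mpoly) \<in> mono_ideal {Poly_Mapping.single v 1}"
    by (auto simp: variable_def intro: aboveI)
  then have "variable v * h \<in> mono_ideal {Poly_Mapping.single v 1}"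
    using ideal_mono_ideal[of "{Poly_Mapping.single v 1}", where ?'k = 'k]
    unfolding ideal_class_iff by (metis mult.commute)
  then have "a \<in> above {Poly_Mapping.single v 1}"
    by (simp flip: h)
  then show "Poly_Mapping.lookup a v > 0"
    by (force simp: above_def dest: spec[of _ v])
next
  assume "Poly_Mapping.lookup a v > 0"
  then have "a = Poly_Mapping.single v 1 + (a - Poly_Mapping.single v 1)"
    by (intro poly_mapping_eqI) (auto simp: lookup_add lookup_minus lookup_single when_def)
  then have "(monomial_of a :: ('n, 'k) mpoly) =
      variable v * monomial_of (a - Poly_Mapping.single v 1)"
    unfolding variable_def monomial_of_mult by simp
  then show "(variable v :: ('n, 'k) mpoly) dvd monomial_of a"
    by (rule dvdI)
qed

lemma squarefree_monomial_of:
  assumes "squarefree (monomial_of b :: ('n, 'k::comm_ring_1) mpoly)"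
  shows "Poly_Mapping.lookup b v \<le> 1"
proof (rule ccontr)
  assume "\<not> Poly_Mapping.lookup b v \<le> 1"
  then have "b = Poly_Mapping.single v 2 + (b - Poly_Mapping.single v 2)"
    by (intro poly_mapping_eqI) (auto simp: lookup_add lookup_minus lookup_single when_def)
  moreover have "(variable v :: ('n, 'k) mpoly) ^ 2 = monomial_of (Poly_Mapping.single v 2)"
    unfolding variable_def monomial_of_power
    by (rule arg_cong[where f = monomial_of], rule poly_mapping_eqI) (simp add: lookup_single when_def)
  ultimately have "(monomial_of b :: ('n, 'k) mpoly) =
      variable v ^ 2 * monomial_of (b - Poly_Mapping.single v 2)"
    by (simp add: monomial_of_mult)
  then have "(variable v :: ('n, 'k) mpoly) ^ 2 dvd monomial_of b"
    by (rule dvdI)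
  \<comment> \<open>Squarefreeness makes a variable whose square divides the monomial a unit, and
    \<open>monomial_of 0\<close> is 1.\<close>
  then have "(variable v :: ('n, 'k) mpoly) dvd monomial_of 0"
    using squarefreeD[OF assms] by (simp add: monomial_of_def)
  then show False
    by (simp add: variable_dvd_monomial_of_iff)
qed

theorem proposition4p3:
  fixes p t :: nat
    and a :: "nat \<Rightarrow> ('n::finite \<Rightarrow>\<^sub>0 nat)"
    and x1 :: 'n
    and m :: "nat \<Rightarrow> ('n, 'k::field) mpoly"
    and m0 :: "('n, 'k) mpoly"
    and b :: "'n \<Rightarrow>\<^sub>0 nat"
    and I :: "('n, 'k) mpoly set"
    and d :: "nat \<Rightarrow> nat"
  assumes "prime p" and "CHAR('k) = p" and "F_finite TYPE('k)"
    and "t \<ge> 1"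
    and "\<And>i. i \<in> {1..t} \<Longrightarrow> m i = monomial_of (a i)"
    and "I = Idl\<^bsub>cring_class_ops\<^esub> (m ` {1..t})"
    and "ideal_height I = 1"
    and "\<And>i. i \<in> {1..t} \<Longrightarrow> variable x1 dvd m i"
    and "\<And>i. i \<in> {1..t} \<Longrightarrow> d i = Poly_Mapping.lookup (a i) x1"
    and "\<And>i. i \<in> {2..t} \<Longrightarrow> d 1 < d i"
    and "m0 = monomial_of b" and "squarefree m0" and "m 1 = m0 ^ d 1"
  shows "lce p I = 1 / real (d 1)"
proof -
  have one: "1 \<in> {1..t}"
    using \<open>t \<ge> 1\<close> by simp
  have "m ` {1..t} = monomial_of ` a ` {1..t}"
    unfolding image_image by (intro image_cong refl assms(5))
  then have I: "I = mono_ideal (a ` {1..t})"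
    by (simp add: assms(6) Idl_monomials)
  have "monomial_of (a 1) = (monomial_of (dilate (d 1) b) :: ('n, 'k) mpoly)"
    using assms(5)[OF one] assms(11,13) by (simp add: monomial_of_power)
  \<comment> \<open>The support of a monomial is the singleton of its exponent, since the
    coefficient 1 is nonzero; comparing supports recovers the exponents.\<close>
  then have "Poly_Mapping.keys (monomial_of (a 1) :: ('n, 'k) mpoly) =
      Poly_Mapping.keys (monomial_of (dilate (d 1) b) :: ('n, 'k) mpoly)"
    by simp
  then have a1: "a 1 = dilate (d 1) b"
    by (simp add: monomial_of_def)
  have "lce CHAR('k) (mono_ideal (a ` {1..t}) :: ('n, 'k) mpoly set) = 1 / real (d 1)"
  proof (rule lce_mono_ideal)
    show "prime CHAR('k)"
      using assms(1,2) by simp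
    \<comment> \<open>Positivity comes from \<open>x1\<close> dividing the first generator.\<close>
    show "d 1 > 0"
      using assms(8)[OF one] unfolding assms(5)[OF one] assms(9)[OF one]
      by (simp only: variable_dvd_monomial_of_iff)
    show "a 1 \<in> a ` {1..t}"
      using one by blast
    show "Poly_Mapping.lookup (a 1) v \<le> d 1" for v
    proof -
      have "Poly_Mapping.lookup b v \<le> 1"
        using assms(12) unfolding assms(11) by (rule squarefree_monomial_of)
      then show ?thesis
        unfolding a1 by simp
    qed
    show "d 1 \<le> Poly_Mapping.lookup c x1" if c: "c \<in> a ` {1..t}" for c
    proof -
      obtain i where i: "i \<in> {1..t}" "c = a i"
        using c by blast
      then show ?thesis
        using assms(9)[of i] assms(10)[of i] by (cases "i = 1") auto
    qed
  qed simp
  then show ?thesis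
    by (simp add: I assms(2))
qed

end
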